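(* Let $d\ge1$ and $\beta>\frac d2+1$. Let $V\in\mathcal{C}^2(\mathbb{R}^d)$ be positive, $\alpha$-strongly convex ($\nabla^2V(x)\succeq\alpha I_d$ for all $x$, with $\alpha>0$) and with $\nabla V$ Lipschitz with constant $L>0$, and let $\pi_\beta\propto V^{-\beta}$ be the associated probability density. Then for any $r\in(0,\beta-\frac d2-1)$, $$\mathbb{E}_{\pi_\beta}[V(X)]\le\left(\frac L\alpha\right)^{\frac{d/2}{\beta-\frac d2-r}}V(0)\left(\frac{\Gamma(\beta)\Gamma(r)}{\Gamma(\frac d2+r)\Gamma(\beta-\frac d2)}\right)^{\frac{1}{\beta-\frac d2-r}},$$ $$\mathbb{E}_{\pi_\beta}\left[|\nabla V(X)|^2\right]\le\frac{dL}{\beta-1}\left(\frac L\alpha\right)^{\frac{d/2}{\beta-\frac d2-r}}V(0)\left(\frac{\Gamma(\beta)\Gamma(r)}{\Gamma(\frac d2+r)\Gamma(\beta-\frac d2)}\right)^{\frac{1}{\beta-\frac d2-r}}.$$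
   Context: $|\cdot|$ is the Euclidean norm, $\Gamma$ is the Gamma function, and $\mathbb{E}_{\pi_\beta}$ denotes expectation with $X\sim\pi_\beta$. *)

theory Defs
  imports "HOL-Probability.Probability"
begin

definition gradient :: "('a::euclidean_space \<Rightarrow> real) \<Rightarrow> 'a \<Rightarrow> 'a" where
  "gradient f x = (THE g. GDERIV f x :> g)"

lemma gradient_eqI:
  assumes "GDERIV f x :> g"
  shows "gradient f x = g"
  unfolding gradient_def
proof (rule the_equality)
  fix h assume "GDERIV f x :> h"
  then have "(\<lambda>v. v \<bullet> h) = (\<lambda>v. v \<bullet> g)"
    using assms has_derivative_unique unfolding gderiv_def by blast
  then show "h = g"
    by (metis inner_commute vector_eq_rdot)
qed (rule assms)

definition hessian :: "(real ^ 'n \<Rightarrow> real) \<Rightarrow> real ^ 'n \<Rightarrow> real ^ 'n ^ 'n" where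
  "hessian f x = matrix (frechet_derivative (gradient f) (at x))"

text \<open>The first two clauses ensure that \<^const>\<open>gradient\<close> and \<^const>\<open>hessian\<close> take no
  unspecified values.\<close>

definition C2 :: "(real ^ 'n \<Rightarrow> real) \<Rightarrow> bool" where
  "C2 f \<longleftrightarrow> (\<forall>x. f differentiable (at x)) \<and> (\<forall>x. gradient f differentiable (at x)) \<and>
     continuous_on UNIV (hessian f)"

text \<open>Only the quadratic form is compared. Symmetry is not required separately: it is automatic
  for multiples of the identity and for Hessians of \<^const>\<open>C2\<close> functions.\<close>

definition loewner_le :: "real ^ 'n ^ 'n \<Rightarrow> real ^ 'n ^ 'n \<Rightarrow> bool" where
  "loewner_le A B \<longleftrightarrow> (\<forall>v. 0 \<le> v \<bullet> ((B - A) *v v))"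

text \<open>The probability measure with Lebesgue density proportional to \<open>V powr (- \<beta>)\<close>. It is a
  probability measure only if the normalising integral is finite and positive (a Bochner integral
  that does not exist is \<open>0\<close>).\<close>

definition power_measure :: "(real ^ 'n \<Rightarrow> real) \<Rightarrow> real \<Rightarrow> (real ^ 'n) measure" where
  "power_measure V \<beta> =
     density lborel (\<lambda>x. ennreal (V x powr (- \<beta>) / (LINT y|lborel. V y powr (- \<beta>))))"

end

theory Submission
  imports Defs
begin

text \<open>Write \<open>D = d / 2\<close>, let \<open>z\<close> be the minimiser of \<open>V\<close>, and let \<open>J p\<close> be the integral of
  \<open>V powr (- p)\<close>.

  Strong convexity and the Lipschitz gradient trap \<open>V\<close> between two paraboloids with the same vertex,
  \<open>V z + \<alpha>/2 |x - z|\<^sup>2 \<le> V x \<le> V z + L/2 |x - z|\<^sup>2\<close>. For a paraboloid the integral \<open>J p\<close> is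
  explicit: writing \<open>a powr (- p)\<close> as a Gamma integral in an auxiliary time \<open>t\<close> and exchanging the
  two integrations leaves a Gaussian integral in \<open>x\<close> and a Gamma integral in \<open>t\<close>
  (\<open>nn_integral_inverse_power_quadratic\<close>). This bounds \<open>J p\<close> above and below for every \<open>p > D\<close>; in
  particular \<open>V powr (- \<beta>)\<close> can be normalised and \<open>V\<close> is integrable.

  Put \<open>s = \<beta> - D - r > 1\<close>. Jensen's inequality gives
  \<open>(E V) powr s \<le> E (V powr s) = J (D + r) / J \<beta>\<close>; the upper bound in the numerator and the lower
  bound in the denominator give \<open>(L/\<alpha>) powr D * V z powr s\<close> times the quotient of Gamma values.
  The first claim follows from \<open>V z \<le> V 0\<close> by taking \<open>s\<close>-th roots.

  For the second claim, formally, integrating the divergence of \<open>V powr (1 - \<beta>) * \<nabla>V\<close> gives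
  \<open>(\<beta> - 1) \<integral> V powr (- \<beta>) |\<nabla>V|\<^sup>2 = \<integral> V powr (1 - \<beta>) \<Delta>V \<le> d L \<integral> V powr (1 - \<beta>)\<close>,
  that is \<open>E |\<nabla>V|\<^sup>2 \<le> d L / (\<beta> - 1) * E V\<close>. This is made rigorous without second
  derivatives and without boundary terms. The function \<open>V powr (1 - \<beta>)\<close> is replaced by \<open>h \<circ> V\<close> of
  compact support. For a unit vector \<open>e\<close> and \<open>u = \<nabla>V \<bullet> e\<close>, translation invariance says that the
  difference quotients of \<open>(h \<circ> V) * u\<close> along \<open>e\<close> have integral zero. By the discrete product rule
  such a quotient is a term where \<open>u\<close> is differenced, which the Lipschitz constant bounds, plus
  one where \<open>h \<circ> V\<close> is differenced, which tends to \<open>h' V * u\<^sup>2\<close>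
  (\<open>integral_directional_energy_le\<close>). Summing over an orthonormal basis and letting \<open>h\<close> increase to
  \<open>v powr (1 - \<beta>)\<close> finishes the argument (\<open>integral_power_energy_le\<close>).\<close>

section \<open>Integrals of inverse powers of paraboloids\<close>

lemma nn_integral_lborel_translate:
  fixes f :: "'a::euclidean_space \<Rightarrow> ennreal"
  assumes [measurable]: "f \<in> borel_measurable borel"
  shows "(\<integral>\<^sup>+x. f (c + x) \<partial>lborel) = (\<integral>\<^sup>+x. f x \<partial>lborel)"
proof -
  have "(\<integral>\<^sup>+x. f x \<partial>lborel) = (\<integral>\<^sup>+x. f x \<partial>distr lborel borel ((+) c))" by (simp add: lborel_distr_plus)
  also have "\<dots> = (\<integral>\<^sup>+x. f (c + x) \<partial>lborel)" by (rule nn_integral_distr) measurable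
  finally show ?thesis by simp
qed

text \<open>The integrand is a multiple of the centred normal density with variance \<open>1 / (2 * s)\<close>.\<close>
lemma nn_integral_gaussian_real:
  fixes s :: real
  assumes "s > 0"
  shows "(\<integral>\<^sup>+x. ennreal (exp (- (s * x\<^sup>2))) \<partial>lborel) = ennreal (sqrt (pi / s))"
proof -
  define \<sigma> where "\<sigma> = sqrt (1 / (2 * s))"
  have \<sigma>: "\<sigma> > 0" "2 * \<sigma>\<^sup>2 = 1 / s" using assms by (auto simp: \<sigma>_def)
  interpret prob_space "density lborel (normal_density 0 \<sigma>)"
    using \<sigma>(1) by (rule prob_space_normal_density)
  have eq: "exp (- (s * x\<^sup>2)) = sqrt (pi / s) * normal_density 0 \<sigma> x" for x
  proof -
    have "2 * pi * \<sigma>\<^sup>2 = pi / s" "x\<^sup>2 / (2 * \<sigma>\<^sup>2) = s * x\<^sup>2"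
      using \<sigma>(2) assms by (auto simp: \<sigma>_def field_simps)
    then show ?thesis unfolding normal_density_def using assms by simp
  qed
  have "(\<integral>\<^sup>+x. ennreal (exp (- (s * x\<^sup>2))) \<partial>lborel)
      = ennreal (sqrt (pi / s)) * (\<integral>\<^sup>+x. ennreal (normal_density 0 \<sigma> x) \<partial>lborel)"
    unfolding eq using assms by (subst ennreal_mult') (auto simp: nn_integral_cmult)
  also have "(\<integral>\<^sup>+x. ennreal (normal_density 0 \<sigma> x) \<partial>lborel) = 1"
    using emeasure_space_1 by (simp add: emeasure_density)
  finally show ?thesis by simp
qed

text \<open>The integrand is a product of functions of single coordinates.\<close>
lemma nn_integral_gaussian:
  fixes s :: real
  assumes "s > 0"
  shows "(\<integral>\<^sup>+(x::'a::euclidean_space). ennreal (exp (- (s * (norm x)\<^sup>2))) \<partial>lborel)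
    = ennreal ((pi / s) powr (DIM('a) / 2))"
proof -
  have "exp (- (s * (norm x)\<^sup>2)) = (\<Prod>b\<in>Basis. exp (- (s * (x \<bullet> b)\<^sup>2)))" for x :: 'a
    by (subst power2_norm_eq_inner, subst euclidean_inner)
       (simp add: exp_sum[symmetric] sum_distrib_left power2_eq_square sum_negf)
  then have "(\<integral>\<^sup>+(x::'a). ennreal (exp (- (s * (norm x)\<^sup>2))) \<partial>lborel)
      = (\<integral>\<^sup>+(x::'a). (\<Prod>b\<in>Basis. ennreal (exp (- (s * (x \<bullet> b)\<^sup>2)))) \<partial>lborel)"
    by (simp add: prod_ennreal)
  also have "\<dots> = ennreal (sqrt (pi / s)) ^ DIM('a)"
    by (subst nn_integral_lborel_prod) (simp_all add: nn_integral_gaussian_real[OF assms])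
  also have "\<dots> = ennreal ((pi / s) powr (DIM('a) / 2))"
    using assms by (simp add: ennreal_power powr_half_sqrt[symmetric] powr_powr powr_realpow[symmetric])
  finally show ?thesis .
qed

text \<open>Substituting \<open>a * t\<close> for \<open>t\<close> in the integral for \<open>Gamma q\<close>. Read from right to left, this
  represents a negative power of \<open>a\<close> as a superposition of exponentials in \<open>a\<close>.\<close>
lemma nn_integral_Gamma_scaled:
  fixes q a :: real
  assumes "q > 0" "a > 0"
  shows "(\<integral>\<^sup>+t. ennreal (indicator {0..} t * t powr (q - 1) * exp (- (a * t))) \<partial>lborel)
    = ennreal (Gamma q * a powr (- q))"
proof -
  have "ennreal (Gamma q) = (\<integral>\<^sup>+t. ennreal (indicator {0..} t * t powr (q - 1) / exp t) \<partial>lborel)"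
    using assms by (rule_tac Gamma_conv_nn_integral_real)
  also have "\<dots> = a * (\<integral>\<^sup>+t. ennreal (indicator {0..} (0 + a * t) * (0 + a * t) powr (q - 1) / exp (0 + a * t)) \<partial>lborel)"
    using assms by (subst nn_integral_real_affine[where c=a and t=0]) auto
  also have "\<dots> = a * (\<integral>\<^sup>+t. ennreal (a powr (q - 1)) * ennreal (indicator {0..} t * t powr (q - 1) * exp (- (a * t))) \<partial>lborel)"
    using assms
    by (intro arg_cong2[where f="(*)"] nn_integral_cong refl)
       (auto simp: indicator_def zero_le_mult_iff powr_mult exp_minus field_simps ennreal_mult'[symmetric])
  also have "\<dots> = ennreal (a powr q) * (\<integral>\<^sup>+t. ennreal (indicator {0..} t * t powr (q - 1) * exp (- (a * t))) \<partial>lborel)"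
    using assms by (subst nn_integral_cmult)
       (auto simp: mult.assoc[symmetric] ennreal_mult'[symmetric] powr_mult_base)
  finally have eq: "ennreal (Gamma q) = ennreal (a powr q) * (\<integral>\<^sup>+t. ennreal (indicator {0..} t * t powr (q - 1) * exp (- (a * t))) \<partial>lborel)" .
  have "ennreal (Gamma q * a powr (- q)) = ennreal (a powr (- q)) * ennreal (Gamma q)"
    by (subst mult.commute) (simp add: ennreal_mult')
  also have "\<dots> = ennreal (a powr (- q) * a powr q) * (\<integral>\<^sup>+t. ennreal (indicator {0..} t * t powr (q - 1) * exp (- (a * t))) \<partial>lborel)"
    unfolding eq by (simp add: ennreal_mult' mult.assoc)
  also have "a powr (- q) * a powr q = 1"
    using assms by (simp add: powr_add[symmetric])
  finally show ?thesis by simp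
qed

text \<open>Expand the power in exponentials by \<open>nn_integral_Gamma_scaled\<close> and integrate first over \<open>x\<close>: the
  Gaussian integral contributes \<open>(pi / (c * t)) powr (DIM('a) / 2)\<close>, which lowers the exponent of
  \<open>t\<close>, so that the remaining integral is again a Gamma integral, now for the parameter
  \<open>q - DIM('a) / 2\<close>.\<close>
lemma nn_integral_inverse_power_quadratic:
  fixes q m c :: real
  assumes "m > 0" "c > 0" "q > DIM('a::euclidean_space) / 2"
  shows "(\<integral>\<^sup>+(x::'a). ennreal ((m + c * (norm x)\<^sup>2) powr (- q)) \<partial>lborel) =
    ennreal ((pi / c) powr (DIM('a) / 2) * m powr (DIM('a) / 2 - q)
      * (Gamma (q - DIM('a) / 2) / Gamma q))"
proof -
  define D where "D = DIM('a) / 2"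
  have D: "D > 0" "q > D" "q > 0" using assms(3) unfolding D_def by (auto simp: less_trans[OF _ assms(3)])
  have G: "Gamma q > 0" "Gamma (q - D) > 0" using D by (auto intro!: Gamma_real_pos)
  let ?g = "\<lambda>(t::real) (x::'a). indicator {0..} t * t powr (q - 1) * exp (- ((m + c * (norm x)\<^sup>2) * t))"
  have "(\<integral>\<^sup>+(x::'a). ennreal (Gamma q) * ennreal ((m + c * (norm x)\<^sup>2) powr (- q)) \<partial>lborel)
      = (\<integral>\<^sup>+(x::'a). (\<integral>\<^sup>+t. ennreal (?g t x) \<partial>lborel) \<partial>lborel)"
    using assms D G
    by (intro nn_integral_cong) (subst nn_integral_Gamma_scaled, auto simp: add_pos_nonneg ennreal_mult')
  also have "\<dots> = (\<integral>\<^sup>+t. (\<integral>\<^sup>+(x::'a). ennreal (?g t x) \<partial>lborel) \<partial>lborel)"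
    by (rule lborel_pair.Fubini'[symmetric]) measurable
  also have "\<dots> = (\<integral>\<^sup>+t. ennreal ((pi / c) powr D) *
      ennreal (indicator {0..} t * t powr ((q - D) - 1) * exp (- (m * t))) \<partial>lborel)"
  proof (rule nn_integral_cong)
    fix t :: real
    show "(\<integral>\<^sup>+(x::'a). ennreal (?g t x) \<partial>lborel) = ennreal ((pi / c) powr D) *
      ennreal (indicator {0..} t * t powr ((q - D) - 1) * exp (- (m * t)))"
    proof (cases "t > 0")
      case True
      have "(\<integral>\<^sup>+(x::'a). ennreal (?g t x) \<partial>lborel) =
        (\<integral>\<^sup>+(x::'a). ennreal (t powr (q - 1) * exp (- (m * t))) * ennreal (exp (- (c * t * (norm x)\<^sup>2))) \<partial>lborel)"
        using True by (intro nn_integral_cong) (auto simp: ennreal_mult'[symmetric] exp_add[symmetric] algebra_simps)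
      also have "\<dots> = ennreal (t powr (q - 1) * exp (- (m * t))) * ennreal ((pi / (c * t)) powr D)"
        using True assms unfolding D_def by (subst nn_integral_cmult) (simp_all add: nn_integral_gaussian)
      also have "(pi / (c * t)) powr D = (pi / c) powr D * t powr (- D)"
        using True assms by (simp add: powr_divide powr_mult powr_minus field_simps)
      also have "ennreal (t powr (q - 1) * exp (- (m * t))) * ennreal ((pi / c) powr D * t powr (- D))
        = ennreal ((pi / c) powr D) * ennreal (indicator {0..} t * t powr ((q - D) - 1) * exp (- (m * t)))"
        using True assms by (simp add: ennreal_mult'[symmetric] powr_diff powr_minus powr_add field_simps)
      finally show ?thesis .
    qed (cases "t = 0", auto)
  qed
  also have "\<dots> = ennreal ((pi / c) powr D) * ennreal (Gamma (q - D) * m powr (- (q - D)))"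
    using D assms by (subst nn_integral_cmult) (simp_all add: nn_integral_Gamma_scaled)
  finally have eq: "ennreal (Gamma q) * (\<integral>\<^sup>+(x::'a). ennreal ((m + c * (norm x)\<^sup>2) powr (- q)) \<partial>lborel)
     = ennreal ((pi / c) powr D * (Gamma (q - D) * m powr (- (q - D))))"
    by (simp add: nn_integral_cmult ennreal_mult')
  have "(\<integral>\<^sup>+(x::'a). ennreal ((m + c * (norm x)\<^sup>2) powr (- q)) \<partial>lborel)
    = ennreal (1 / Gamma q * Gamma q) * (\<integral>\<^sup>+(x::'a). ennreal ((m + c * (norm x)\<^sup>2) powr (- q)) \<partial>lborel)"
    using G by simp
  also have "\<dots> = ennreal (1 / Gamma q) * ennreal ((pi / c) powr D * (Gamma (q - D) * m powr (- (q - D))))"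
    unfolding eq[symmetric] using G by (subst ennreal_mult') (auto simp: mult.assoc)
  also have "\<dots> = ennreal (1 / Gamma q * ((pi / c) powr D * (Gamma (q - D) * m powr (- (q - D)))))"
    using G by (intro ennreal_mult'[symmetric]) simp
  finally show ?thesis unfolding D_def[symmetric] by (simp add: mult_ac)
qed

lemma nn_integral_inverse_power_quadratic_centered:
  fixes q m c :: real and z :: "'a::euclidean_space"
  assumes "m > 0" "c > 0" "q > DIM('a) / 2"
  shows "(\<integral>\<^sup>+x. ennreal ((m + c * (norm (x - z))\<^sup>2) powr (- q)) \<partial>lborel) =
    ennreal ((pi / c) powr (DIM('a) / 2) * m powr (DIM('a) / 2 - q)
      * (Gamma (q - DIM('a) / 2) / Gamma q))"
  using nn_integral_lborel_translate[of "\<lambda>x. ennreal ((m + c * (norm x)\<^sup>2) powr (- q))" "- z"]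
    nn_integral_inverse_power_quadratic[OF assms] by simp

lemma integral_inverse_power_le:
  fixes V :: "'a::euclidean_space \<Rightarrow> real"
  assumes meas: "V \<in> borel_measurable borel"
    and "m > 0" "c > 0" "q > DIM('a) / 2"
    and lower: "\<And>x. m + c * (norm (x - z))\<^sup>2 \<le> V x"
  shows "integrable lborel (\<lambda>x. V x powr (- q))"
    and "(LINT x|lborel. V x powr (- q)) \<le> (pi / c) powr (DIM('a) / 2) * m powr (DIM('a) / 2 - q)
      * (Gamma (q - DIM('a) / 2) / Gamma q)" (is "_ \<le> ?C")
proof -
  note [measurable] = meas
  have q: "q > 0" using assms(4) by (rule le_less_trans[rotated]) simp
  have "(\<integral>\<^sup>+x. ennreal (V x powr (- q)) \<partial>lborel) \<le> (\<integral>\<^sup>+x. ennreal ((m + c * (norm (x - z))\<^sup>2) powr (- q)) \<partial>lborel)"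
    using q assms by (intro nn_integral_mono ennreal_leI powr_mono2') (auto simp: add_pos_nonneg)
  also have "\<dots> = ennreal ?C" using assms by (intro nn_integral_inverse_power_quadratic_centered)
  finally have le: "(\<integral>\<^sup>+x. ennreal (V x powr (- q)) \<partial>lborel) \<le> ennreal ?C" .
  then show int: "integrable lborel (\<lambda>x. V x powr (- q))"
    by (intro integrableI_nonneg) (auto intro: le_less_trans)
  have "ennreal (LINT x|lborel. V x powr (- q)) \<le> ennreal ?C"
    using le nn_integral_eq_integral[OF int] by simp
  moreover have "?C \<ge> 0" using assms q by (auto intro!: mult_nonneg_nonneg divide_nonneg_nonneg Gamma_real_nonneg)
  ultimately show "(LINT x|lborel. V x powr (- q)) \<le> ?C" by (simp add: ennreal_le_iff)
qed

lemma integral_inverse_power_ge: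
  fixes V :: "'a::euclidean_space \<Rightarrow> real"
  assumes int: "integrable lborel (\<lambda>x. V x powr (- q))" and pos: "\<And>x. 0 < V x"
    and "m > 0" "c > 0" "q > DIM('a) / 2"
    and upper: "\<And>x. V x \<le> m + c * (norm (x - z))\<^sup>2"
  shows "(pi / c) powr (DIM('a) / 2) * m powr (DIM('a) / 2 - q)
      * (Gamma (q - DIM('a) / 2) / Gamma q) \<le> (LINT x|lborel. V x powr (- q))" (is "?C \<le> _")
proof -
  have q: "q > 0" using assms(5) by (rule le_less_trans[rotated]) simp
  have "ennreal ?C = (\<integral>\<^sup>+x. ennreal ((m + c * (norm (x - z))\<^sup>2) powr (- q)) \<partial>lborel)"
    using assms by (intro nn_integral_inverse_power_quadratic_centered[symmetric])
  also have "\<dots> \<le> (\<integral>\<^sup>+x. ennreal (V x powr (- q)) \<partial>lborel)"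
    using q pos upper by (intro nn_integral_mono ennreal_leI powr_mono2') auto
  also have "\<dots> = ennreal (LINT x|lborel. V x powr (- q))"
    using int by (intro nn_integral_eq_integral) auto
  finally show ?thesis by (subst (asm) ennreal_le_iff) auto
qed

section \<open>Quadratic bounds for strongly convex functions with Lipschitz gradient\<close>

lemma GDERIV_along_line:
  assumes "GDERIV f (x + t *\<^sub>R v) :> g"
  shows "((\<lambda>s. f (x + s *\<^sub>R v)) has_real_derivative (g \<bullet> v)) (at t)"
proof -
  have "((\<lambda>s. x + s *\<^sub>R v) has_derivative (\<lambda>s. s *\<^sub>R v)) (at t)"
    by (auto intro!: derivative_eq_intros)
  from has_derivative_compose[OF this assms[unfolded gderiv_def]]
  show ?thesis unfolding has_field_derivative_def
    by (simp add: inner_commute mult_commute_abs)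
qed

text \<open>By the Riesz representation, every linear functional on a Euclidean space is an inner product.\<close>
lemma GDERIV_gradient:
  fixes f :: "'a::euclidean_space \<Rightarrow> real"
  assumes "f differentiable (at x)"
  shows "GDERIV f x :> gradient f x"
proof -
  obtain D where D: "(f has_derivative D) (at x)" using assms by (auto simp: differentiable_def)
  interpret D: bounded_linear D using D by (rule has_derivative_bounded_linear)
  have "D h = h \<bullet> (\<Sum>b\<in>Basis. D b *\<^sub>R b)" for h
  proof -
    have "D h = D (\<Sum>b\<in>Basis. (h \<bullet> b) *\<^sub>R b)" by (simp add: euclidean_representation)
    also have "\<dots> = h \<bullet> (\<Sum>b\<in>Basis. D b *\<^sub>R b)"
      by (simp add: D.sum D.scaleR inner_sum_right mult.commute)
    finally show ?thesis .
  qed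
  then have "D = (\<lambda>h. h \<bullet> (\<Sum>b\<in>Basis. D b *\<^sub>R b))" by (rule ext)
  with D have "GDERIV f x :> (\<Sum>b\<in>Basis. D b *\<^sub>R b)" unfolding gderiv_def by metis
  with gradient_eqI[OF this] show ?thesis by simp
qed

text \<open>Along the segment from \<open>x\<close> to \<open>y\<close> the function \<open>gradient V \<bullet> (y - x)\<close> has as its derivative the
  quadratic form of the Hessian, so that the mean value theorem applies.\<close>
lemma hessian_bound_imp_strongly_monotone_gradient:
  fixes V :: "real ^ 'n \<Rightarrow> real"
  assumes "C2 V" and hess: "\<And>x. loewner_le (mat \<alpha>) (hessian V x)"
  shows "\<alpha> * (norm (y - x))\<^sup>2 \<le> (gradient V y - gradient V x) \<bullet> (y - x)"
proof -
  define v where "v = y - x"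
  define G where "G t = gradient V (x + t *\<^sub>R v) \<bullet> v" for t
  have G': "(G has_real_derivative v \<bullet> (hessian V (x + t *\<^sub>R v) *v v)) (at t)" for t
  proof -
    define D where "D = frechet_derivative (gradient V) (at (x + t *\<^sub>R v))"
    have D: "(gradient V has_derivative D) (at (x + t *\<^sub>R v))"
      using assms(1) unfolding C2_def D_def by (auto simp: frechet_derivative_works)
    have line: "((\<lambda>s. x + s *\<^sub>R v) has_derivative (\<lambda>s. s *\<^sub>R v)) (at t)"
      by (auto intro!: derivative_eq_intros)
    have lin: "linear D" using D by (rule has_derivative_linear)
    have "(G has_derivative (\<lambda>s. D (s *\<^sub>R v) \<bullet> v)) (at t)"
      unfolding G_def using has_derivative_compose[OF line D]
      by (intro has_derivative_inner_left)
    moreover have "hessian V (x + t *\<^sub>R v) *v v = D v"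
      unfolding hessian_def D_def[symmetric] using matrix_vector_mul(2)[OF lin] by (rule fun_cong)
    moreover have "(\<lambda>s. D (s *\<^sub>R v) \<bullet> v) = (*) (v \<bullet> D v)"
      by (simp add: fun_eq_iff linear_cmul[OF lin] inner_commute)
    ultimately show ?thesis
      by (simp only: has_field_derivative_def)
  qed
  have bound: "\<alpha> * (norm v)\<^sup>2 \<le> v \<bullet> (hessian V z *v v)" for z
  proof -
    have "mat \<alpha> *v v = \<alpha> *\<^sub>R v"
      by (simp add: vec_eq_iff matrix_vector_mult_def mat_def if_distrib[of "\<lambda>x. x * _"] cong: if_cong)
    moreover have "0 \<le> v \<bullet> ((hessian V z - mat \<alpha>) *v v)"
      using hess[of z] unfolding loewner_le_def by blast
    ultimately show ?thesis
      by (simp add: matrix_vector_mult_diff_rdistrib inner_diff_right power2_norm_eq_inner)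
  qed
  obtain z where "G 1 - G 0 = (1 - 0) * (v \<bullet> (hessian V (x + z *\<^sub>R v) *v v))"
    using MVT2[of 0 1 G, OF _ G'] by auto
  then have "\<alpha> * (norm v)\<^sup>2 \<le> G 1 - G 0" using bound by simp
  then show ?thesis by (simp add: G_def v_def inner_diff_left)
qed

text \<open>The difference of the two sides, restricted to the ray from \<open>x\<close> through \<open>y\<close>, has nonnegative
  derivative. The number \<open>\<alpha>\<close> may be negative: applied to \<open>- V\<close> with \<open>\<alpha> = - L\<close>, the lemma yields
  the quadratic majorant.\<close>
lemma strongly_monotone_gradient_imp_quadratic_minorant:
  fixes V :: "'a::euclidean_space \<Rightarrow> real"
  assumes gd: "\<And>x. GDERIV V x :> g x"
    and mono: "\<And>x y. \<alpha> * (norm (y - x))\<^sup>2 \<le> (g y - g x) \<bullet> (y - x)"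
  shows "V x + g x \<bullet> (y - x) + \<alpha> / 2 * (norm (y - x))\<^sup>2 \<le> V y"
proof -
  define v where "v = y - x"
  define f where "f t = V (x + t *\<^sub>R v) - t * (g x \<bullet> v) - \<alpha> / 2 * t\<^sup>2 * (norm v)\<^sup>2" for t
  have f': "(f has_real_derivative (g (x + t *\<^sub>R v) \<bullet> v - g x \<bullet> v - \<alpha> * t * (norm v)\<^sup>2)) (at t)" for t
    unfolding f_def by (auto intro!: derivative_eq_intros GDERIV_along_line gd)
  have "f 0 \<le> f 1"
  proof (rule DERIV_nonneg_imp_nondecreasing[of 0 1], simp)
    fix t :: real assume t: "0 \<le> t" "t \<le> 1"
    have "0 \<le> g (x + t *\<^sub>R v) \<bullet> v - g x \<bullet> v - \<alpha> * t * (norm v)\<^sup>2"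
    proof (cases "t = 0")
      case False
      have "t * (\<alpha> * t * (norm v)\<^sup>2) \<le> t * (g (x + t *\<^sub>R v) \<bullet> v - g x \<bullet> v)"
        using mono[of "x + t *\<^sub>R v" x] by (simp add: power_mult_distrib power2_eq_square inner_diff_left algebra_simps)
      then show ?thesis using t False by (simp add: mult_le_cancel_left)
    qed simp
    then show "\<exists>z. (f has_real_derivative z) (at t) \<and> 0 \<le> z" using f' by blast
  qed
  then show ?thesis by (simp add: f_def v_def)
qed

lemma lipschitz_gradient_imp_quadratic_majorant:
  fixes V :: "'a::euclidean_space \<Rightarrow> real" and L :: real
  assumes gd: "\<And>x. GDERIV V x :> g x" and lip: "L-lipschitz_on UNIV g"
  shows "V y \<le> V x + g x \<bullet> (y - x) + L / 2 * (norm (y - x))\<^sup>2"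
proof -
  have "- L * (norm (y - x))\<^sup>2 \<le> (- g y - - g x) \<bullet> (y - x)" for x y
  proof -
    have "(g y - g x) \<bullet> (y - x) \<le> norm (g y - g x) * norm (y - x)" by (rule norm_cauchy_schwarz)
    also have "\<dots> \<le> L * norm (y - x) * norm (y - x)"
      using lipschitz_onD[OF lip, of y x] by (intro mult_right_mono) (auto simp: dist_norm)
    finally show ?thesis by (simp add: power2_eq_square inner_diff_left)
  qed
  from strongly_monotone_gradient_imp_quadratic_minorant[OF GDERIV_minus[OF gd] this, of x y]
  show ?thesis by simp
qed

text \<open>The gradient step with step size \<open>1 / L\<close> minimises the quadratic majorant at \<open>x\<close>. There the majorant has
  the value \<open>V x - (norm (g x))\<^sup>2 / (2 * L)\<close>, which is nonnegative because \<open>V\<close> is.\<close>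
lemma norm_gradient_le_of_lipschitz_gradient:
  fixes V :: "'a::euclidean_space \<Rightarrow> real" and L :: real
  assumes gd: "\<And>x. GDERIV V x :> g x" and lip: "L-lipschitz_on UNIV g" and "L > 0"
    and nonneg: "\<And>x. 0 \<le> V x"
  shows "(norm (g x))\<^sup>2 \<le> 2 * L * V x"
proof -
  define y where "y = x - (1 / L) *\<^sub>R g x"
  have "0 \<le> V y" by (rule nonneg)
  also have "V y \<le> V x + g x \<bullet> (y - x) + L / 2 * (norm (y - x))\<^sup>2"
    by (rule lipschitz_gradient_imp_quadratic_majorant[OF gd lip])
  also have "\<dots> = V x - (norm (g x))\<^sup>2 / (2 * L)"
    using \<open>L > 0\<close> by (simp add: y_def power2_norm_eq_inner[symmetric] power_divide) (simp add: field_simps power2_eq_square)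
  finally show ?thesis using \<open>L > 0\<close> by (simp add: field_simps)
qed

text \<open>By the quadratic minorant at \<open>0\<close>, values smaller than \<open>V 0\<close> occur only in the ball of radius
  \<open>2 * norm (g 0) / \<alpha>\<close>, which is compact.\<close>
lemma strongly_convex_attains_minimum:
  fixes V :: "'a::euclidean_space \<Rightarrow> real"
  assumes gd: "\<And>x. GDERIV V x :> g x" and "\<alpha> > 0"
    and mono: "\<And>x y. \<alpha> * (norm (y - x))\<^sup>2 \<le> (g y - g x) \<bullet> (y - x)"
  obtains z where "\<And>x. V z \<le> V x" and "g z = 0"
proof -
  have cont: "continuous_on UNIV V"
    using gd unfolding gderiv_def by (meson continuous_at_imp_continuous_on has_derivative_continuous)
  define R where "R = 2 * norm (g 0) / \<alpha>"
  have R: "R \<ge> 0" using \<open>\<alpha> > 0\<close> by (simp add: R_def)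
  obtain z where z: "z \<in> cball 0 R" "\<And>x. x \<in> cball 0 R \<Longrightarrow> V z \<le> V x"
    using continuous_attains_inf[of "cball 0 R" V] cont R
    by (metis centre_in_cball compact_cball continuous_on_subset empty_iff top_greatest)
  have min: "V z \<le> V x" for x
  proof (cases "x \<in> cball 0 R")
    case False
    then have nx: "norm x > R" by simp
    have "V z \<le> V 0" using z(2) R by simp
    also have "V 0 \<le> V 0 + norm x * (\<alpha> / 2 * norm x - norm (g 0))"
      using nx \<open>\<alpha> > 0\<close> R by (intro le_add_same_cancel1[THEN iffD2] mult_nonneg_nonneg) (auto simp: R_def field_simps)
    also have "\<dots> \<le> V 0 + g 0 \<bullet> x + \<alpha> / 2 * (norm x)\<^sup>2"
      using norm_cauchy_schwarz[of "- g 0" x] by (simp add: algebra_simps power2_eq_square)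
    also have "\<dots> \<le> V x"
      using strongly_monotone_gradient_imp_quadratic_minorant[OF gd mono, of 0 x] by simp
    finally show ?thesis .
  qed (rule z(2))
  have "(\<lambda>h. h \<bullet> g z) = (\<lambda>h. 0)"
    using gd[of z] min unfolding gderiv_def
    by (intro differential_zero_maxmin[of z UNIV V "\<lambda>h. h \<bullet> g z"]) auto
  then have "g z = 0" by (metis inner_eq_zero_iff)
  with min that show thesis by blast
qed

section \<open>An energy estimate without second derivatives\<close>

lemma lborel_translate:
  fixes f :: "'a::euclidean_space \<Rightarrow> real"
  assumes "integrable lborel f"
  shows "integrable lborel (\<lambda>x. f (c + x))" "(LINT x|lborel. f (c + x)) = (LINT x|lborel. f x)"
proof -
  have [measurable]: "f \<in> borel_measurable borel" using assms by auto
  have "integrable (distr lborel borel ((+) c)) f" using assms by (simp add: lborel_distr_plus)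
  then show "integrable lborel (\<lambda>x. f (c + x))" by (subst (asm) integrable_distr_eq) auto
  have "(LINT x|lborel. f x) = (LINT x|distr lborel borel ((+) c). f x)" by (simp add: lborel_distr_plus)
  also have "\<dots> = (LINT x|lborel. f (c + x))" by (rule integral_distr) measurable
  finally show "(LINT x|lborel. f (c + x)) = (LINT x|lborel. f x)" by simp
qed

lemma integrable_continuous_compact_support:
  fixes f :: "'a::euclidean_space \<Rightarrow> real"
  assumes "continuous_on UNIV f" "\<And>x. norm x > R \<Longrightarrow> f x = 0"
  shows "integrable lborel f"
proof -
  have "integrable lborel (\<lambda>x. indicator (cball 0 R) x *\<^sub>R f x)"
    by (rule borel_integrable_compact) (auto intro: continuous_on_subset[OF assms(1)])
  also have "(\<lambda>x. indicator (cball 0 R) x *\<^sub>R f x) = f"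
    using assms(2) by (auto simp: indicator_def fun_eq_iff not_le)
  finally show ?thesis .
qed

text \<open>This is integration by parts for \<open>h (V x) * (g x \<bullet> e)\<close> in the direction \<open>e\<close>, with the Lipschitz
  constant of \<open>g\<close> in place of the derivative of \<open>g x \<bullet> e\<close>. It is carried out on difference quotients
  with steps \<open>1 / (n + 1)\<close>, whose integrals vanish by translation invariance. Compact support
  supplies the domination that the limit needs.\<close>
lemma integral_directional_energy_le:
  fixes V :: "'a::euclidean_space \<Rightarrow> real" and h h' :: "real \<Rightarrow> real" and L :: real
  assumes gd: "\<And>x. GDERIV V x :> g x" and lip: "L-lipschitz_on UNIV g" and pos: "\<And>x. 0 < V x"
    and h: "\<And>v. v > 0 \<Longrightarrow> (h has_real_derivative h' v) (at v)"
    and h': "continuous_on {0<..} h'"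
    and nonneg: "\<And>v. v > 0 \<Longrightarrow> 0 \<le> h v"
    and supp: "\<And>x. norm x > R \<Longrightarrow> h (V x) = 0"
    and e: "norm e = 1"
  shows "integrable lborel (\<lambda>x. h' (V x) * (g x \<bullet> e)\<^sup>2)" (is ?int)
    and "(LINT x|lborel. - h' (V x) * (g x \<bullet> e)\<^sup>2) \<le> L * (LINT x|lborel. h (V x))" (is ?le)
proof -
  define H where "H x = h (V x)" for x
  define u where "u x = g x \<bullet> e" for x
  have cV: "continuous_on UNIV V"
    using gd unfolding gderiv_def by (meson continuous_at_imp_continuous_on has_derivative_continuous)
  have cg: "continuous_on UNIV g" using lip by (rule lipschitz_on_continuous_on)
  have cu: "continuous_on UNIV u" unfolding u_def using cg by (intro continuous_intros)
  have ch: "continuous_on {0<..} h" using h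
    by (meson DERIV_isCont continuous_at_imp_continuous_on greaterThan_iff)
  have cH: "continuous_on UNIV H" unfolding H_def
    using pos by (intro continuous_on_compose2[OF ch cV]) auto
  have ch'V: "continuous_on UNIV (\<lambda>x. h' (V x))"
    using pos by (intro continuous_on_compose2[OF h' cV]) auto
  have [measurable]: "H \<in> borel_measurable borel" "u \<in> borel_measurable borel"
    using cH cu by (auto intro: borel_measurable_continuous_onI)
  have intH: "integrable lborel H"
    using cH supp by (intro integrable_continuous_compact_support[of _ R]) (auto simp: H_def)
  have intF: "integrable lborel (\<lambda>x. H x * u x)"
    using cH cu supp by (intro integrable_continuous_compact_support[of _ R] continuous_intros) (auto simp: H_def)
  have Hline: "((\<lambda>s. H (x + s *\<^sub>R e)) has_real_derivative h' (V (x + t *\<^sub>R e)) * u (x + t *\<^sub>R e)) (at t)" for x t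
    unfolding H_def u_def using DERIV_chain2[OF h[OF pos] GDERIV_along_line[OF gd]] .
  have cd: "continuous_on UNIV (\<lambda>x. h' (V x) * u x)" using ch'V cu by (intro continuous_intros)

  \<comment> \<open>The negated difference quotient of \<open>h \<circ> V\<close> with step \<open>1 / (n + 1)\<close>, times \<open>u\<close>.\<close>
  define D where "D n x = - ((H (x + inverse (Suc n) *\<^sub>R e) - H x) / inverse (Suc n)) * u x" for n x
  \<comment> \<open>The quotients vanish outside the ball of radius \<open>R + 1\<close>, and the intermediate points of the mean value theorem stay within \<open>R + 2\<close>.\<close>
  have bounded: "\<exists>B. \<forall>x. norm x \<le> R + 2 \<longrightarrow> norm (f x) \<le> B"
    if "continuous_on UNIV f" for f :: "'a \<Rightarrow> real"
  proof -
    have "bounded (f ` cball 0 (R + 2))"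
      by (rule compact_imp_bounded[OF compact_continuous_image[OF continuous_on_subset[OF that subset_UNIV] compact_cball]])
    then obtain B where "\<forall>x\<in>cball 0 (R + 2). norm (f x) \<le> B" by (auto simp: bounded_iff)
    then have "\<forall>x. norm x \<le> R + 2 \<longrightarrow> norm (f x) \<le> B" by (simp add: Ball_def)
    then show ?thesis ..
  qed
  obtain M where M: "\<And>x. norm x \<le> R + 2 \<Longrightarrow> norm (h' (V x) * u x) \<le> M"
    using bounded[OF cd] by blast
  obtain N where N: "\<And>x. norm x \<le> R + 2 \<Longrightarrow> norm (u x) \<le> N"
    using bounded[OF cu] by blast
  have Dbound: "norm (D n x) \<le> indicator (cball 0 (R + 1)) x * (M * N)" for n x
  proof -
    define t where "t = inverse (real (Suc n))"
    have t: "0 < t" "t \<le> 1" by (auto simp: t_def field_simps)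
    have te: "norm (s *\<^sub>R e) \<le> 1" if "0 \<le> s" "s \<le> t" for s
      using that t e by simp
    show ?thesis
    proof (cases "norm x \<le> R + 1")
      case True
      obtain z where z: "0 < z" "z < t" and
        eq: "H (x + t *\<^sub>R e) - H (x + 0 *\<^sub>R e) = (t - 0) * (h' (V (x + z *\<^sub>R e)) * u (x + z *\<^sub>R e))"
        using MVT2[OF t(1), of "\<lambda>s. H (x + s *\<^sub>R e)", OF Hline] by blast
      have "norm (x + z *\<^sub>R e) \<le> R + 2"
        using norm_triangle_ineq[of x "z *\<^sub>R e"] te[of z] z True by simp
      from M[OF this] have 1: "norm ((H (x + t *\<^sub>R e) - H x) / t) \<le> M" using eq t by simp
      have "norm (u x) \<le> N" using N True by simp
      then have "norm (- ((H (x + t *\<^sub>R e) - H x) / t) * u x) \<le> M * N"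
        unfolding norm_mult norm_minus_cancel using 1 order_trans[OF norm_ge_zero 1] by (intro mult_mono) auto
      then show ?thesis using True by (simp add: D_def t_def)
    next
      case False
      then have "norm x > R" "norm (x + t *\<^sub>R e) > R"
        using norm_triangle_ineq4[of "x + t *\<^sub>R e" "t *\<^sub>R e"] te[of t] t by auto
      then show ?thesis using False by (simp add: D_def t_def H_def supp)
    qed
  qed
  have Dlim: "(\<lambda>n. D n x) \<longlonglongrightarrow> - h' (V x) * (u x)\<^sup>2" for x
  proof -
    have "((\<lambda>t. (H (x + t *\<^sub>R e) - H x) / t) \<longlongrightarrow> h' (V x) * u x) (at 0)"
      using Hline[of x 0] by (simp add: DERIV_def)
    moreover have "filterlim (\<lambda>n. inverse (real (Suc n))) (at 0) sequentially"
      using LIMSEQ_inverse_real_of_nat by (intro filterlim_atI) auto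
    ultimately have *: "(\<lambda>n. (H (x + inverse (Suc n) *\<^sub>R e) - H x) / inverse (Suc n)) \<longlonglongrightarrow> h' (V x) * u x"
      by (rule filterlim_compose)
    have "(\<lambda>n. - ((H (x + inverse (Suc n) *\<^sub>R e) - H x) / inverse (Suc n)) * u x) \<longlonglongrightarrow> - (h' (V x) * u x) * u x"
      by (intro tendsto_intros *)
    then show ?thesis by (simp add: D_def power2_eq_square mult.assoc)
  qed
  have dom: "integrable lborel (\<lambda>x::'a. indicator (cball 0 (R + 1)) x * (M * N))"
    by (intro integrable_mult_left integrable_real_indicator) (use emeasure_bounded_finite[OF bounded_cball, of 0 "R + 1"] in auto)
  have Dm: "D n \<in> borel_measurable lborel" for n unfolding D_def by measurable
  have lm: "(\<lambda>x. - h' (V x) * (u x)\<^sup>2) \<in> borel_measurable lborel"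
    using ch'V cu by (auto intro!: borel_measurable_continuous_onI continuous_intros)
  have int: "integrable lborel (\<lambda>x. - h' (V x) * (u x)\<^sup>2)"
    by (rule integrable_dominated_convergence[where s=D, OF lm Dm dom AE_I2[OF Dlim] AE_I2[OF Dbound]])
  then show ?int using integrable_mult_right[OF int, of "- 1"] by (simp add: u_def)
  have conv: "(\<lambda>n. LINT x|lborel. D n x) \<longlonglongrightarrow> (LINT x|lborel. - h' (V x) * (u x)\<^sup>2)"
    by (rule integral_dominated_convergence[where s=D, OF lm Dm dom AE_I2[OF Dlim] AE_I2[OF Dbound]])
  have "(LINT x|lborel. D n x) \<le> L * (LINT x|lborel. H x)" for n
  proof -
    define t where "t = inverse (real (Suc n))"
    have t: "t > 0" by (simp add: t_def)
    define c where "c = t *\<^sub>R e"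
    have intD: "integrable lborel (D n)"
      by (rule Bochner_Integration.integrable_bound[OF dom Dm], rule AE_I2, unfold real_norm_def)
         (rule order_trans[OF Dbound[unfolded real_norm_def] abs_ge_self])
    have "0 = (LINT x|lborel. H (c + x) * u (c + x) - H x * u x)"
      using lborel_translate[OF intF, of c] intF by simp
    then have 0: "0 = (LINT x|lborel. (H (c + x) * u (c + x) - H x * u x) / t)" using t by simp
    have "(LINT x|lborel. D n x) = (LINT x|lborel. D n x) + (LINT x|lborel. (H (c + x) * u (c + x) - H x * u x) / t)"
      using 0 by simp
    \<comment> \<open>Adding the full difference quotient cancels the differences of \<open>H\<close> and leaves those of \<open>u\<close>.\<close>
    also have "\<dots> = (LINT x|lborel. D n x + (H (c + x) * u (c + x) - H x * u x) / t)"
      using lborel_translate[OF intF, of c] intF intD by (subst Bochner_Integration.integral_add) auto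
    also have "\<dots> \<le> (LINT x|lborel. L * H (c + x))"
    proof (rule integral_mono)
      show "integrable lborel (\<lambda>x. D n x + (H (c + x) * u (c + x) - H x * u x) / t)"
        using lborel_translate[OF intF, of c] intF intD by auto
      show "integrable lborel (\<lambda>x. L * H (c + x))" using lborel_translate[OF intH, of c] by simp
      fix x
      have xc: "x + c = c + x" by (rule add.commute)
      have "u (c + x) - u x \<le> norm (g (c + x) - g x) * norm e"
        unfolding u_def inner_diff_left[symmetric] by (rule norm_cauchy_schwarz)
      also have "\<dots> \<le> L * t"
        using lipschitz_onD[OF lip, of "c + x" x] e t by (simp add: dist_norm c_def)
      finally have "H (c + x) * (u (c + x) - u x) \<le> H (c + x) * (L * t)"
        by (intro mult_left_mono) (auto simp: H_def nonneg pos)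
      moreover have "D n x + (H (c + x) * u (c + x) - H x * u x) / t = H (c + x) * (u (c + x) - u x) / t"
        unfolding D_def t_def[symmetric] c_def[symmetric] xc using t by (simp add: divide_simps) (simp add: algebra_simps)
      ultimately show "D n x + (H (c + x) * u (c + x) - H x * u x) / t \<le> L * H (c + x)"
        using t by (simp add: field_simps)
    qed
    also have "\<dots> = L * (LINT x|lborel. H x)" using lborel_translate[OF intH, of c] by simp
    finally show ?thesis .
  qed
  then have "(LINT x|lborel. - h' (V x) * (u x)\<^sup>2) \<le> L * (LINT x|lborel. H x)"
    by (intro LIMSEQ_le_const2[OF conv]) auto
  then show ?le by (simp add: u_def H_def)
qed

lemma integral_energy_le:
  fixes V :: "'a::euclidean_space \<Rightarrow> real" and h h' :: "real \<Rightarrow> real" and L :: real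
  assumes gd: "\<And>x. GDERIV V x :> g x" and lip: "L-lipschitz_on UNIV g" and pos: "\<And>x. 0 < V x"
    and h: "\<And>v. v > 0 \<Longrightarrow> (h has_real_derivative h' v) (at v)"
    and h': "continuous_on {0<..} h'"
    and nonneg: "\<And>v. v > 0 \<Longrightarrow> 0 \<le> h v"
    and supp: "\<And>x. norm x > R \<Longrightarrow> h (V x) = 0"
  shows "(LINT x|lborel. - h' (V x) * (norm (g x))\<^sup>2) \<le> DIM('a) * L * (LINT x|lborel. h (V x))"
proof -
  note dir = integral_directional_energy_le[OF gd lip pos h h' nonneg supp norm_Basis]
  have "- h' (V x) * (norm (g x))\<^sup>2 = (\<Sum>b\<in>Basis. - h' (V x) * (g x \<bullet> b)\<^sup>2)" for x
    by (subst power2_norm_eq_inner, subst euclidean_inner)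
       (simp add: sum_distrib_left power2_eq_square sum_negf)
  then have "(LINT x|lborel. - h' (V x) * (norm (g x))\<^sup>2) = (\<Sum>b\<in>Basis. LINT x|lborel. - h' (V x) * (g x \<bullet> b)\<^sup>2)"
    using dir(1) by (simp add: Bochner_Integration.integral_sum)
  also have "\<dots> \<le> (\<Sum>b::'a\<in>Basis. L * (LINT x|lborel. h (V x)))"
    by (intro sum_mono dir(2))
  finally show ?thesis by (simp add: mult.assoc)
qed

lemma DERIV_max_0_square: "((\<lambda>u::real. (max 0 u)\<^sup>2) has_real_derivative 2 * max 0 u) (at u)"
proof (cases "u = 0")
  case True
  have "((\<lambda>y::real. (max 0 y)\<^sup>2 / y) \<longlongrightarrow> 0) (at 0)"
  proof (rule tendsto_0_le[where K=1])
    show "((\<lambda>y::real. y) \<longlongrightarrow> 0) (at 0)" by (rule tendsto_ident_at)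
    show "\<forall>\<^sub>F y in at 0. norm ((max 0 y)\<^sup>2 / y) \<le> norm (y::real) * 1"
      by (intro always_eventually allI) (auto simp: max_def power2_eq_square)
  qed
  then show ?thesis using True by (simp add: DERIV_def)
next
  case False
  show ?thesis
  proof (cases "u > 0")
    case True
    have "((\<lambda>u::real. u\<^sup>2) has_real_derivative 2 * max 0 u) (at u)"
      using True by (auto intro!: derivative_eq_intros)
    then show ?thesis
      by (rule has_field_derivative_transform_within_open[where S="{0<..}"]) (use True in auto)
  next
    case False
    then have "u < 0" using \<open>u \<noteq> 0\<close> by simp
    have "((\<lambda>u::real. 0) has_real_derivative 2 * max 0 u) (at u)"
      using \<open>u < 0\<close> by (auto intro!: derivative_eq_intros)
    then show ?thesis
      by (rule has_field_derivative_transform_within_open[where S="{..<0}"]) (use \<open>u < 0\<close> in auto)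
  qed
qed

text \<open>The lemma \<open>integral_energy_le\<close> is applied to \<open>h n v = (max 0 (v powr (- a) - k n))\<^sup>2\<close> with
  \<open>a = (\<beta> - 1) / 2\<close> and \<open>k n = (n + 1) powr (- a)\<close>. Squaring the positive part makes \<open>h n\<close> continuously
  differentiable although it vanishes from \<open>v = n + 1\<close> on, and \<open>a\<close> is chosen so that \<open>h n v\<close> tends
  to \<open>v powr (1 - \<beta>)\<close>. Both \<open>h n\<close> and \<open>- h' n\<close> stay below their limits, which gives the
  domination. The limit is integrable because \<open>norm_gradient_le_of_lipschitz_gradient\<close> bounds the
  squared gradient by a multiple of \<open>V\<close>.\<close>
lemma integral_power_energy_le:
  fixes V :: "'a::euclidean_space \<Rightarrow> real" and L :: real
  assumes gd: "\<And>x. GDERIV V x :> g x" and lip: "L-lipschitz_on UNIV g" and "L > 0"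
    and pos: "\<And>x. 0 < V x"
    and sublevel: "\<And>K. bounded {x. V x \<le> K}"
    and "\<beta> > 1" and int: "integrable lborel (\<lambda>x. V x powr (1 - \<beta>))"
  shows "integrable lborel (\<lambda>x. V x powr (- \<beta>) * (norm (g x))\<^sup>2)" (is ?int)
    and "(\<beta> - 1) * (LINT x|lborel. V x powr (- \<beta>) * (norm (g x))\<^sup>2)
      \<le> DIM('a) * L * (LINT x|lborel. V x powr (1 - \<beta>))" (is ?le)
proof -
  define a where "a = (\<beta> - 1) / 2"
  have a: "a > 0" "2 * a = \<beta> - 1" using \<open>\<beta> > 1\<close> by (auto simp: a_def)
  define k where "k n = real (Suc n) powr (- a)" for n
  define h where "h n v = (max 0 (v powr (- a) - k n))\<^sup>2" for n v
  define h' where "h' n v = - (2 * a * v powr (- a - 1) * max 0 (v powr (- a) - k n))" for n v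
  have cV: "continuous_on UNIV V"
    using gd unfolding gderiv_def by (meson continuous_at_imp_continuous_on has_derivative_continuous)
  have cg: "continuous_on UNIV g" using lip by (rule lipschitz_on_continuous_on)
  have [measurable]: "V \<in> borel_measurable borel" "g \<in> borel_measurable borel"
    using cV cg by (auto intro: borel_measurable_continuous_onI)
  have k0: "k n \<ge> 0" for n by (simp add: k_def)
  have klim: "k \<longlonglongrightarrow> 0" unfolding k_def using a
    by (intro tendsto_neg_powr filterlim_compose[OF filterlim_real_sequentially filterlim_Suc]) auto
  have hder: "(h n has_real_derivative h' n v) (at v)" if "v > 0" for n v
  proof -
    have "((\<lambda>v. v powr (- a) - k n) has_real_derivative - a * v powr (- a - 1)) (at v)"
      using that by (auto intro!: derivative_eq_intros)
    from DERIV_chain2[OF DERIV_max_0_square this] show ?thesis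
      by (simp add: h_def[abs_def] h'_def mult_ac)
  qed
  have h'cont: "continuous_on {0<..} (h' n)" for n
    unfolding h'_def by (auto intro!: continuous_intros)
  have supp: "\<exists>R. \<forall>x. norm x > R \<longrightarrow> h n (V x) = 0" for n
  proof -
    obtain R where R: "\<And>x. V x \<le> real (Suc n) \<Longrightarrow> norm x \<le> R"
      using sublevel[of "real (Suc n)"] by (auto simp: bounded_iff)
    have "h n (V x) = 0" if "norm x > R" for x
    proof -
      have "V x > real (Suc n)" using R[of x] that by linarith
      then have "V x powr (- a) \<le> k n" unfolding k_def using a by (intro powr_mono2') auto
      then show ?thesis by (simp add: h_def)
    qed
    then show ?thesis by blast
  qed
  have sq: "(v powr (- a))\<^sup>2 = v powr (1 - \<beta>)" if "v > 0" for v
    using that a by (simp add: power2_eq_square powr_add[symmetric])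
  have prod: "2 * a * v powr (- a - 1) * v powr (- a) = (\<beta> - 1) * v powr (- \<beta>)" if "v > 0" for v
  proof -
    have "- a - 1 + - a = - \<beta>" using a by simp
    then show ?thesis using that by (simp add: a mult.assoc powr_add[symmetric])
  qed
  have h_le: "0 \<le> h n v" "h n v \<le> v powr (1 - \<beta>)" if "v > 0" for n v
  proof -
    have "h n v \<le> (v powr (- a))\<^sup>2" unfolding h_def using k0[of n] by (intro power_mono) auto
    then show "0 \<le> h n v" "h n v \<le> v powr (1 - \<beta>)" using sq[OF that] by (auto simp: h_def)
  qed
  have h'_le: "0 \<le> - h' n v" "- h' n v \<le> (\<beta> - 1) * v powr (- \<beta>)" if "v > 0" for n v
  proof -
    have "- h' n v \<le> 2 * a * v powr (- a - 1) * v powr (- a)"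
      unfolding h'_def using k0[of n] a by (simp add: mult_left_mono)
    then show "0 \<le> - h' n v" "- h' n v \<le> (\<beta> - 1) * v powr (- \<beta>)"
      using prod[OF that] a by (auto simp: h'_def)
  qed
  have energy: "(LINT x|lborel. - h' n (V x) * (norm (g x))\<^sup>2) \<le> DIM('a) * L * (LINT x|lborel. V x powr (1 - \<beta>))" for n
  proof -
    obtain R where R: "\<And>x. norm x > R \<Longrightarrow> h n (V x) = 0" using supp[of n] by blast
    have "(LINT x|lborel. - h' n (V x) * (norm (g x))\<^sup>2) \<le> DIM('a) * L * (LINT x|lborel. h n (V x))"
      by (rule integral_energy_le[OF gd lip pos hder h'cont h_le(1) R])
    also have "(LINT x|lborel. h n (V x)) \<le> (LINT x|lborel. V x powr (1 - \<beta>))"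
      using int h_le pos by (intro integral_mono_AE' AE_I2) auto
    finally show ?thesis using \<open>L > 0\<close> by (simp add: mult_left_mono)
  qed
  have bound: "V x powr (- \<beta>) * (norm (g x))\<^sup>2 \<le> 2 * L * V x powr (1 - \<beta>)" for x
  proof -
    have "V x powr (- \<beta>) * (norm (g x))\<^sup>2 \<le> V x powr (- \<beta>) * (2 * L * V x)"
      using norm_gradient_le_of_lipschitz_gradient[OF gd lip \<open>L > 0\<close> less_imp_le[OF pos]]
      by (intro mult_left_mono) auto
    also have "\<dots> = 2 * L * V x powr (1 - \<beta>)"
      using pos[of x] by (simp add: powr_diff powr_minus field_simps)
    finally show ?thesis .
  qed
  have meas: "(\<lambda>x. V x powr (- \<beta>) * (norm (g x))\<^sup>2) \<in> borel_measurable lborel" by measurable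
  show int2: ?int
    by (rule Bochner_Integration.integrable_bound[OF integrable_mult_right[OF int, of "2 * L"] meas])
       (use bound \<open>L > 0\<close> in auto)
  have "(\<lambda>n. LINT x|lborel. - h' n (V x) * (norm (g x))\<^sup>2) \<longlonglongrightarrow> (LINT x|lborel. (\<beta> - 1) * (V x powr (- \<beta>) * (norm (g x))\<^sup>2))"
  proof (rule integral_dominated_convergence[where w="\<lambda>x. (\<beta> - 1) * (V x powr (- \<beta>) * (norm (g x))\<^sup>2)"])
    show "integrable lborel (\<lambda>x. (\<beta> - 1) * (V x powr (- \<beta>) * (norm (g x))\<^sup>2))" using int2 by simp
    show "AE x in lborel. norm (- h' n (V x) * (norm (g x))\<^sup>2) \<le> (\<beta> - 1) * (V x powr (- \<beta>) * (norm (g x))\<^sup>2)" for n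
    proof (rule AE_I2)
      fix x
      have "norm (- h' n (V x) * (norm (g x))\<^sup>2) = - h' n (V x) * (norm (g x))\<^sup>2"
        using h'_le(1)[OF pos[of x], of n] by (simp add: abs_mult)
      also have "\<dots> \<le> ((\<beta> - 1) * V x powr (- \<beta>)) * (norm (g x))\<^sup>2"
        using h'_le(2)[OF pos[of x], of n] by (intro mult_right_mono) auto
      finally show "norm (- h' n (V x) * (norm (g x))\<^sup>2) \<le> (\<beta> - 1) * (V x powr (- \<beta>) * (norm (g x))\<^sup>2)"
        by (simp add: mult.assoc)
    qed
    show "AE x in lborel. (\<lambda>n. - h' n (V x) * (norm (g x))\<^sup>2) \<longlonglongrightarrow> (\<beta> - 1) * (V x powr (- \<beta>) * (norm (g x))\<^sup>2)"
    proof (rule AE_I2)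
      fix x
      have "(\<lambda>n. 2 * a * V x powr (- a - 1) * max 0 (V x powr (- a) - k n) * (norm (g x))\<^sup>2)
        \<longlonglongrightarrow> 2 * a * V x powr (- a - 1) * max 0 (V x powr (- a) - 0) * (norm (g x))\<^sup>2"
        by (intro tendsto_intros klim)
      also have "2 * a * V x powr (- a - 1) * max 0 (V x powr (- a) - 0) * (norm (g x))\<^sup>2
        = (\<beta> - 1) * (V x powr (- \<beta>) * (norm (g x))\<^sup>2)"
        using prod[OF pos[of x]] by simp
      finally show "(\<lambda>n. - h' n (V x) * (norm (g x))\<^sup>2) \<longlonglongrightarrow> (\<beta> - 1) * (V x powr (- \<beta>) * (norm (g x))\<^sup>2)"
        by (simp add: h'_def)
    qed
  qed (auto simp: h'_def)
  then have "(LINT x|lborel. (\<beta> - 1) * (V x powr (- \<beta>) * (norm (g x))\<^sup>2)) \<le> DIM('a) * L * (LINT x|lborel. V x powr (1 - \<beta>))"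
    by (rule LIMSEQ_le_const2) (use energy in auto)
  then show ?le by simp
qed

section \<open>The moment bounds\<close>

theorem proposition4:
  fixes V :: "real ^ 'n \<Rightarrow> real" and \<alpha> \<beta> L d r :: real
  assumes "d = real CARD('n)"
    and "\<beta> > d / 2 + 1"
    and "C2 V"
    and "\<And>x. V x > 0"
    and "\<alpha> > 0"
    and "\<And>x. loewner_le (mat \<alpha>) (hessian V x)"
    and "L > 0"
    and "L-lipschitz_on UNIV (gradient V)"
    and "r \<in> {0<..<\<beta> - d / 2 - 1}"
  shows "prob_space (power_measure V \<beta>) \<and>
    integrable (power_measure V \<beta>) V \<and>
    (LINT x|power_measure V \<beta>. V x) \<le>
      (L / \<alpha>) powr ((d / 2) / (\<beta> - d / 2 - r)) * V 0 *
      ((Gamma \<beta> * Gamma r) / (Gamma (d / 2 + r) * Gamma (\<beta> - d / 2))) powr (1 / (\<beta> - d / 2 - r)) \<and>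
    integrable (power_measure V \<beta>) (\<lambda>x. (norm (gradient V x))\<^sup>2) \<and>
    (LINT x|power_measure V \<beta>. (norm (gradient V x))\<^sup>2) \<le>
      (d * L) / (\<beta> - 1) *
      (L / \<alpha>) powr ((d / 2) / (\<beta> - d / 2 - r)) * V 0 *
      ((Gamma \<beta> * Gamma r) / (Gamma (d / 2 + r) * Gamma (\<beta> - d / 2))) powr (1 / (\<beta> - d / 2 - r))"
proof -
  note d = assms(1) and \<beta> = assms(2) and C2 = assms(3) and pos = assms(4) and \<alpha> = assms(5)
    and hess = assms(6) and L = assms(7) and lip = assms(8)
  define D where "D = d / 2"
  define s where "s = \<beta> - D - r"
  define q where "q = D + r"
  define Z where "Z = (LINT x|lborel. V x powr (- \<beta>))"
  define M where "M = power_measure V \<beta>"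
  have DIM: "real DIM(real ^ 'n) = d" by (simp add: d)
  have D: "D > 0" "real DIM(real ^ 'n) / 2 = D" unfolding D_def using d by simp_all
  have s: "s > 1" "0 < r" "q > D" "\<beta> > D + 1" "\<beta> - 1 > D" "\<beta> > D" "q - D = r" "\<beta> - q = s" "q > 0" "\<beta> > 1"
    using assms(9) \<beta> D(1) unfolding D_def s_def q_def by auto

  have gd: "GDERIV V x :> gradient V x" for x
    using C2 by (intro GDERIV_gradient) (simp add: C2_def)
  note mono = hessian_bound_imp_strongly_monotone_gradient[OF C2 hess]
  obtain z where z: "\<And>x. V z \<le> V x" "gradient V z = 0"
    using strongly_convex_attains_minimum[OF gd \<alpha> mono] by blast
  have lower: "V z + \<alpha> / 2 * (norm (x - z))\<^sup>2 \<le> V x" for x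
    using strongly_monotone_gradient_imp_quadratic_minorant[OF gd mono, of z x] z(2) by simp
  have upper: "V x \<le> V z + L / 2 * (norm (x - z))\<^sup>2" for x
    using lipschitz_gradient_imp_quadratic_majorant[OF gd lip, of x z] z(2) by simp
  have cV: "continuous_on UNIV V"
    using gd unfolding gderiv_def by (meson continuous_at_imp_continuous_on has_derivative_continuous)
  then have mV[measurable]: "V \<in> borel_measurable borel" by (rule borel_measurable_continuous_onI)
  have mg[measurable]: "gradient V \<in> borel_measurable borel"
    using lip by (intro borel_measurable_continuous_onI lipschitz_on_continuous_on)
  have half: "\<alpha> / 2 > 0" "L / 2 > 0" using \<alpha> L by auto
  have sublevel: "bounded {x. V x \<le> K}" for K
  proof (rule bounded_subset[OF bounded_cball])
    show "{x. V x \<le> K} \<subseteq> cball z (sqrt (2 * K / \<alpha>))"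
    proof
      fix x assume "x \<in> {x. V x \<le> K}"
      then have "\<alpha> / 2 * (norm (x - z))\<^sup>2 \<le> K" using lower[of x] pos[of z] by simp
      then have "(norm (x - z))\<^sup>2 \<le> 2 * K / \<alpha>" using \<alpha> by (simp add: field_simps)
      then have "norm (x - z) \<le> sqrt (2 * K / \<alpha>)" by (rule real_le_rsqrt)
      then show "x \<in> cball z (sqrt (2 * K / \<alpha>))" by (simp add: dist_norm norm_minus_commute)
    qed
  qed

  note up = integral_inverse_power_le[OF mV pos[of z] half(1) _ lower, unfolded D(2)]
  have int\<beta>: "integrable lborel (\<lambda>x. V x powr (- \<beta>))" by (rule up(1)) (use s in simp)
  have intq: "integrable lborel (\<lambda>x. V x powr (- q))" by (rule up(1)) (use s in simp)
  have int1: "integrable lborel (\<lambda>x. V x powr (1 - \<beta>))" using up(1)[of "\<beta> - 1"] s by simp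
  have Z_ge: "(pi / (L / 2)) powr D * V z powr (D - \<beta>) * (Gamma (\<beta> - D) / Gamma \<beta>) \<le> Z"
    unfolding Z_def using integral_inverse_power_ge[OF int\<beta> pos pos[of z] half(2) _ upper] s D by simp
  have Gpos: "Gamma \<beta> > 0" "Gamma (\<beta> - D) > 0" "Gamma q > 0" "Gamma r > 0"
    using s by (auto intro!: Gamma_real_pos)
  have Z_low: "0 < (pi / (L / 2)) powr D * V z powr (D - \<beta>) * (Gamma (\<beta> - D) / Gamma \<beta>)"
    using Gpos L pos[of z] by simp
  then have Z: "Z > 0" using Z_ge by simp

  have M: "M = density lborel (\<lambda>x. ennreal (V x powr (- \<beta>) / Z))"
    unfolding M_def power_measure_def Z_def ..
  have M_integrable: "integrable M f \<longleftrightarrow> integrable lborel (\<lambda>x. V x powr (- \<beta>) * f x)"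
    if [measurable]: "f \<in> borel_measurable borel" for f
    unfolding M using Z integrable_mult_left_iff[where c="1 / Z" and M=lborel and f="\<lambda>x. V x powr (- \<beta>) * f x"]
    by (subst integrable_density) auto
  have M_integral: "(LINT x|M. f x) = (LINT x|lborel. V x powr (- \<beta>) * f x) / Z"
    if [measurable]: "f \<in> borel_measurable borel" for f
    unfolding M using Z by (subst integral_density) auto
  have prob: "prob_space M"
  proof
    have "emeasure M (space M) = (\<integral>\<^sup>+x. ennreal (V x powr (- \<beta>) / Z) \<partial>lborel)"
      unfolding M by (simp add: emeasure_density)
    also have "\<dots> = ennreal (LINT x|lborel. V x powr (- \<beta>) / Z)"
      using int\<beta> Z by (intro nn_integral_eq_integral) auto
    also have "(LINT x|lborel. V x powr (- \<beta>) / Z) = 1" using Z by (simp add: Z_def)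
    finally show "emeasure M (space M) = 1" by simp
  qed
  have shift: "V x powr (- \<beta>) * V x = V x powr (1 - \<beta>)" for x
    using pos[of x] by (simp add: powr_diff powr_minus field_simps)
  have shift_s: "V x powr (- \<beta>) * V x powr s = V x powr (- q)" for x
  proof -
    have "- \<beta> + s = - q" using s by simp
    then show ?thesis by (simp only: powr_add[symmetric])
  qed
  have intV: "integrable M V" using int1 by (simp add: M_integrable shift)
  have intVs: "integrable M (\<lambda>x. V x powr s)" using intq by (simp add: M_integrable shift_s)
  define EV where "EV = (LINT x|M. V x)"
  have EV: "EV = (LINT x|lborel. V x powr (1 - \<beta>)) / Z" by (simp add: EV_def M_integral shift)
  define G where "G = Gamma \<beta> * Gamma r / (Gamma q * Gamma (\<beta> - D))"
  have G: "G > 0" using Gpos by (simp add: G_def)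

  have "EV powr s \<le> (LINT x|M. V x powr s)" unfolding EV_def
    by (rule prob_space.jensens_inequality[where X=V and I="{0<..}" and a=0 and q="\<lambda>v. v powr s", OF prob intV _ _ intVs powr_convex])
       (use pos s in auto)
  also have "\<dots> = (LINT x|lborel. V x powr (- q)) / Z" by (simp add: M_integral shift_s)
  also have "\<dots> \<le> ((pi / (\<alpha> / 2)) powr D * V z powr (D - q) * (Gamma r / Gamma q))
      / ((pi / (L / 2)) powr D * V z powr (D - \<beta>) * (Gamma (\<beta> - D) / Gamma \<beta>))"
    using up(2)[of q] s Z_ge Z_low by (intro frac_le) (auto intro: integral_nonneg_AE)
  also have "\<dots> = (L / \<alpha>) powr D * V z powr s * G"
  proof -
    have "(pi / (\<alpha> / 2)) powr D = (L / \<alpha>) powr D * (pi / (L / 2)) powr D"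
      using \<alpha> L by (subst powr_mult[symmetric]) (auto simp: field_simps)
    moreover have "D - q = s + (D - \<beta>)" using s by simp
    then have "V z powr (D - q) = V z powr s * V z powr (D - \<beta>)" by (simp only: powr_add)
    ultimately show ?thesis unfolding G_def using Gpos L pos[of z] by (simp add: divide_simps)
  qed
  also have "\<dots> \<le> (L / \<alpha>) powr D * V 0 powr s * G"
    using z(1)[of 0] pos[of z] s G \<alpha> L by (intro mult_right_mono mult_left_mono powr_mono2) auto
  finally have "(EV powr s) powr (1 / s) \<le> ((L / \<alpha>) powr D * V 0 powr s * G) powr (1 / s)"
    using s by (intro powr_mono2) auto
  moreover have EV0: "EV \<ge> 0" unfolding EV using Z by (simp add: integral_nonneg_AE)
  ultimately have EV_le: "EV \<le> (L / \<alpha>) powr (D / s) * V 0 * G powr (1 / s)"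
    using s G \<alpha> L pos[of 0] by (simp add: powr_powr powr_mult)

  note energy = integral_power_energy_le[OF gd lip L pos sublevel s(10) int1]
  have intg: "integrable M (\<lambda>x. (norm (gradient V x))\<^sup>2)"
    using energy(1) by (simp add: M_integrable)
  have "(LINT x|M. (norm (gradient V x))\<^sup>2) = (LINT x|lborel. V x powr (- \<beta>) * (norm (gradient V x))\<^sup>2) / Z"
    by (simp add: M_integral)
  also have "\<dots> \<le> d * L / (\<beta> - 1) * EV"
  proof -
    have "(LINT x|lborel. V x powr (- \<beta>) * (norm (gradient V x))\<^sup>2)
        \<le> d * L * (LINT x|lborel. V x powr (1 - \<beta>)) / (\<beta> - 1)"
      using energy(2) s(10) unfolding DIM by (simp add: pos_le_divide_eq mult.commute)
    from divide_right_mono[OF this less_imp_le[OF Z]] show ?thesis by (simp add: EV)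
  qed
  also have "\<dots> \<le> d * L / (\<beta> - 1) * ((L / \<alpha>) powr (D / s) * V 0 * G powr (1 / s))"
    using EV_le s L d by (intro mult_left_mono) auto
  finally have Eg_le: "(LINT x|M. (norm (gradient V x))\<^sup>2)
    \<le> d * L / (\<beta> - 1) * (L / \<alpha>) powr (D / s) * V 0 * G powr (1 / s)"
    by (simp add: mult.assoc)
  show ?thesis
    using prob intV EV_le intg Eg_le unfolding M_def G_def EV_def s_def q_def D_def by blast
qed

end
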